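(* Let $k\geq 2$ be an integer and let $\mathbf{t}^{(k)}$ be the generalized Thue-Morse sequence defined below. For every integer $n\geq k$, writing $n\equiv r \pmod k$ with $r\in\{0,1,\dots,k-1\}$, we have \[\rho_n^{ab}(\mathbf{t}^{(k)}) = \begin{cases} \frac{1}{4}k(k^2-1)+1 & \text{if $k$ is odd and $r=0$},\\ \frac{1}{4}k(k-1)^2+k & \text{if $k$ is odd and $r\neq 0$},\\ \frac{1}{4}k^3+1 & \text{if $k$ is even and $r=0$},\\ \frac{1}{4}k(k-1)^2+\frac{5}{4}k & \text{if $k$ is even and $r\neq 0$ is even},\\ \frac{1}{4}k^2(k-2)+k & \text{if $k$ is even and $r\neq 0$ is odd}. \end{cases}\]
   Context: Let $\Sigma_k=\{0,1,\dots,k-1\}$. Let $\sigma_k$ be the morphism on $\Sigma_k^*$ given by $\sigma_k(i)=i\,(i+1)\,(i+2)\cdots(i+k-1)$ with all letters taken modulo $k$ (so $0\mapsto 01\cdots(k-1)$, $1\mapsto 12\cdots(k-1)0$, etc.). The generalized Thue-Morse sequence is $\mathbf{t}^{(k)}=\sigma_k^\infty(0)$, the infinite fixed point of $\sigma_k$ beginning with $0$. For a word $v$ over $\Sigma_k$, its Parikh vector is $\psi(v)=(|v|_0,|v|_1,\dots,|v|_{k-1})$, where $|v|_a$ is the number of occurrences of the letter $a$ in $v$. For an infinite word $\mathbf{w}$, $\mathcal{F}_n(\mathbf{w})$ denotes the set of its factors (contiguous finite subwords) of length $n$, and the abelian complexity is $\rho_n^{ab}(\mathbf{w})=\#\{\psi(v):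 v\in\mathcal{F}_n(\mathbf{w})\}$. *)

theory Defs
  imports Complex_Main
begin

text \<open>
  Finite words over \<open>\<Sigma>\<^sub>k = {0, \<dots>, k - 1}\<close> are lists of naturals below \<open>k\<close>; infinite words are
  functions from positions (starting at 0) to letters.
\<close>

definition tm_letter :: "nat \<Rightarrow> nat \<Rightarrow> nat list" where
  "tm_letter k i = map (\<lambda>j. (i + j) mod k) [0..<k]"

definition tm_morphism :: "nat \<Rightarrow> nat list \<Rightarrow> nat list" where
  "tm_morphism k v = concat (map (tm_letter k) v)"

text \<open>
  For \<open>k \<ge> 2\<close> the words \<open>\<sigma>\<^sub>k\<^sup>m(0)\<close> have length \<open>k\<^sup>m > m\<close> and each is a prefix of the next, so
  letter \<open>m\<close> of the limit word \<open>\<sigma>\<^sub>k\<^sup>\<infinity>(0)\<close> is letter \<open>m\<close> of \<open>\<sigma>\<^sub>k\<^sup>m(0)\<close>. The lemmas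
  \<open>gen_thue_morse_prefix\<close>, \<open>gen_thue_morse_fixed_point\<close> and \<open>gen_thue_morse_unique\<close> below
  confirm that this is the unique fixed point of \<open>\<sigma>\<^sub>k\<close> beginning with 0.
\<close>

definition gen_thue_morse :: "nat \<Rightarrow> nat \<Rightarrow> nat" where
  "gen_thue_morse k m = ((tm_morphism k ^^ m) [0]) ! m"

definition factors :: "nat \<Rightarrow> (nat \<Rightarrow> 'a) \<Rightarrow> 'a list set" where
  "factors n w = {map w [i..<i + n] | i. True}"

definition parikh :: "nat \<Rightarrow> nat list \<Rightarrow> nat list" where
  "parikh k v = map (count_list v) [0..<k]"

definition abelian_complexity :: "nat \<Rightarrow> (nat \<Rightarrow> nat) \<Rightarrow> nat \<Rightarrow> nat" where
  "abelian_complexity k w n = card (parikh k ` factors n w)"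

lemma length_tm_letter [simp]: "length (tm_letter k i) = k"
  by (simp add: tm_letter_def)

lemma tm_morphism_append: "tm_morphism k (u @ v) = tm_morphism k u @ tm_morphism k v"
  by (simp add: tm_morphism_def)

lemma length_tm_morphism [simp]: "length (tm_morphism k v) = k * length v"
  by (induction v) (simp_all add: tm_morphism_def)

lemma length_tm_iterate [simp]: "length ((tm_morphism k ^^ m) v) = k ^ m * length v"
  by (induction m) simp_all

lemma nth_tm_morphism:
  assumes "i < k * length v"
  shows "tm_morphism k v ! i = (v ! (i div k) + i mod k) mod k"
  using assms
proof (induction v arbitrary: i)
  case Nil
  then show ?case by simp
next
  case (Cons a v)
  have k: "k > 0" using Cons.prems by (cases k) auto
  show ?case
  proof (cases "i < k")
    case True
    then show ?thesis
      by (simp add: tm_morphism_def nth_append) (simp add: tm_letter_def)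
  next
    case False
    then have i: "i - k < k * length v" "i div k = Suc ((i - k) div k)" "(i - k) mod k = i mod k"
      using Cons.prems k by (auto simp: le_div_geq le_mod_geq)
    have "tm_morphism k (a # v) ! i = tm_morphism k v ! (i - k)"
      using False by (simp add: tm_morphism_def nth_append)
    then show ?thesis using Cons.IH[OF i(1)] i by simp
  qed
qed

lemma tm_iterate_step:
  assumes "k > 0"
  shows "\<exists>u. (tm_morphism k ^^ Suc m) [0] = (tm_morphism k ^^ m) [0] @ u"
proof (induction m)
  case 0
  obtain k' where "k = Suc k'" using assms by (cases k) auto
  then show ?case
    by (simp add: tm_morphism_def tm_letter_def upt_conv_Cons del: upt_Suc)
next
  case (Suc m)
  then obtain u where "(tm_morphism k ^^ Suc m) [0] = (tm_morphism k ^^ m) [0] @ u" by blast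
  then have "(tm_morphism k ^^ Suc (Suc m)) [0] = tm_morphism k ((tm_morphism k ^^ m) [0] @ u)"
    by simp
  then show ?case by (simp add: tm_morphism_append)
qed

lemma tm_iterate_mono:
  assumes "k > 0" "m \<le> m'"
  shows "\<exists>u. (tm_morphism k ^^ m') [0] = (tm_morphism k ^^ m) [0] @ u"
  using assms(2)
proof (induction m' rule: dec_induct)
  case base
  then show ?case by simp
next
  case (step n)
  from step.IH obtain u where u: "(tm_morphism k ^^ n) [0] = (tm_morphism k ^^ m) [0] @ u"
    by blast
  obtain v where "(tm_morphism k ^^ Suc n) [0] = (tm_morphism k ^^ n) [0] @ v"
    using tm_iterate_step[OF assms(1), of n] by blast
  then show ?case unfolding u by simp
qed

lemma gen_thue_morse_prefix:
  assumes "k \<ge> 2" "i < k ^ m"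
  shows "gen_thue_morse k i = ((tm_morphism k ^^ m) [0]) ! i"
proof -
  have i: "i < k ^ i" using assms(1) by (simp add: power_gt_expt)
  consider "m \<le> i" | "i \<le> m" by linarith
  then show ?thesis
  proof cases
    case 1
    then obtain u where "(tm_morphism k ^^ i) [0] = (tm_morphism k ^^ m) [0] @ u"
      using tm_iterate_mono[of k m i] assms by auto
    then show ?thesis using assms by (simp add: gen_thue_morse_def nth_append)
  next
    case 2
    then obtain u where "(tm_morphism k ^^ m) [0] = (tm_morphism k ^^ i) [0] @ u"
      using tm_iterate_mono[of k i m] assms by auto
    then show ?thesis using i by (simp add: gen_thue_morse_def nth_append)
  qed
qed

lemma gen_thue_morse_0: "gen_thue_morse k 0 = 0"
  by (simp add: gen_thue_morse_def)

lemma gen_thue_morse_fixed_point: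
  assumes "k \<ge> 2"
  shows "gen_thue_morse k i = tm_letter k (gen_thue_morse k (i div k)) ! (i mod k)"
proof -
  have i: "i < k ^ i" using assms by (simp add: power_gt_expt)
  have d: "i div k < k ^ i" using i by (meson div_le_dividend le_less_trans)
  have "i < k ^ Suc i" using power_gt_expt[of k "Suc i"] assms by linarith
  then have "gen_thue_morse k i = tm_morphism k ((tm_morphism k ^^ i) [0]) ! i"
    using gen_thue_morse_prefix[OF assms, of i "Suc i"] by simp
  also have "\<dots> = (gen_thue_morse k (i div k) + i mod k) mod k"
    using \<open>i < k ^ Suc i\<close> gen_thue_morse_prefix[OF assms d] by (simp add: nth_tm_morphism)
  finally show ?thesis using assms by (simp add: tm_letter_def)
qed

lemma gen_thue_morse_unique:
  assumes "k \<ge> 2" "w 0 = 0" "\<And>i. w i = tm_letter k (w (i div k)) ! (i mod k)"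
  shows "w = gen_thue_morse k"
proof
  fix i
  show "w i = gen_thue_morse k i"
  proof (induction i rule: less_induct)
    case (less i)
    show ?case
    proof (cases "i = 0")
      case True
      then show ?thesis using assms(2) by (simp add: gen_thue_morse_0)
    next
      case False
      then have "i div k < i" using assms(1) by simp
      then show ?thesis
        using less assms(3)[of i] gen_thue_morse_fixed_point[OF assms(1), of i] by simp
    qed
  qed
qed

end

theory Submission
  imports Defs "HOL-Library.Multiset"
begin

text \<open>
  Write \<open>t\<close> for the sequence. Since \<open>t (k * I + j) = t I + j\<close> modulo \<open>k\<close>, the cyclic difference
  \<open>c \<mapsto> |v|\<^sub>c - |v|\<^sub>c\<^sub>-\<^sub>1\<close> of the Parikh vector of a factor \<open>v\<close> of length \<open>n\<close> at position \<open>i\<close> telescopes to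
  the signed multiset \<open>P - Q\<close> with \<open>P = {t i, t ((i + n) div k)}\<close> and
  \<open>Q = {t (i div k), t (i + n)}\<close>, where \<open>\<Sum>Q \<equiv> \<Sum>P + n\<close> modulo \<open>k\<close>. A vector of given total is
  determined by its cyclic difference, and for \<open>n \<ge> k\<close> every such pair \<open>(P, Q)\<close> occurs, because every
  pair of letters occurs in \<open>t\<close> at every positive distance. Hence the abelian complexity
  is the number of distinct \<open>P - Q\<close>. This is the number of pairs \<open>(P, Q)\<close>, corrected for the
  pairs that intersect.
\<close>

section \<open>Pairs of letters at a fixed distance\<close>

lemma gen_thue_morse_rec:
  assumes "k \<ge> 2"
  shows "gen_thue_morse k i = (gen_thue_morse k (i div k) + i mod k) mod k"
  using gen_thue_morse_fixed_point[OF assms, of i] assms by (simp add: tm_letter_def)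

lemma gen_thue_morse_less: "k \<ge> 2 \<Longrightarrow> gen_thue_morse k i < k"
  by (subst gen_thue_morse_rec) auto

lemma gen_thue_morse_block:
  assumes "k \<ge> 2" "j < k"
  shows "gen_thue_morse k (k * i + j) = (gen_thue_morse k i + j) mod k"
  using assms by (subst gen_thue_morse_rec) auto

lemma gen_thue_morse_small: "k \<ge> 2 \<Longrightarrow> a < k \<Longrightarrow> gen_thue_morse k a = a"
  using gen_thue_morse_block[of k a 0] by (simp add: gen_thue_morse_0)

text \<open>On naturals, \<open>k - d\<close> plays the part of \<open>-d\<close> modulo
  \<open>k\<close>; letters with a prescribed residue are built this way throughout.\<close>

lemma mod_add_eq_solve:
  fixes b d k :: nat
  assumes "b < k" "d \<le> k"
  shows "((b + (k - d)) mod k + d) mod k = b"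
  using assms by (simp add: mod_add_left_eq)

lemma mod_add_left_cancel:
  fixes x y z k :: nat
  assumes "(z + x) mod k = (z + y) mod k" "x < k" "y < k"
  shows "x = y"
proof -
  have "int k dvd int x - int y"
    using assms(1) by (metis add_diff_cancel_left mod_eq_dvd_iff of_nat_add of_nat_mod)
  then show ?thesis
    using assms(2,3) zdvd_imp_le[of "int k" "\<bar>int x - int y\<bar>"] by fastforce
qed

text \<open>Induction on the cyclic difference \<open>c\<close> from \<open>a\<close> up to
  \<open>b\<close>. Difference 1 occurs inside a block. If \<open>a'\<close> is followed by
  \<open>b\<close>, then at the border of their blocks \<open>a' - 1\<close> is followed by
  \<open>b\<close>, so the difference grows by one.\<close>

lemma gen_thue_morse_adjacent_pair:
  assumes k: "k \<ge> 2" and "a < k" "b < k"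
  shows "\<exists>i. gen_thue_morse k i = a \<and> gen_thue_morse k (Suc i) = b"
proof -
  let ?t = "gen_thue_morse k"
  have "\<exists>i. ?t i = (b + (k - c)) mod k \<and> ?t (Suc i) = b" if "1 \<le> c" "c \<le> k" for c
    using that
  proof (induction c rule: dec_induct)
    case base
    define a where "a = (b + (k - 1)) mod k"
    have "a < k" "(a + 1) mod k = b"
      using assms mod_add_eq_solve[of b k 1] by (auto simp: a_def)
    \<comment> \<open>The letter at position \<open>a\<close> is \<open>a\<close> itself, so the
      block starting at \<open>k * a\<close> begins with \<open>a\<close> and its successor.\<close>
    then have "?t (k * a + 0) = a" "?t (k * a + 1) = b"
      using gen_thue_morse_block[of k 0 a] gen_thue_morse_block[of k 1 a] k
      by (simp_all add: gen_thue_morse_small)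
    then show ?case unfolding a_def by auto
  next
    case (step c)
    then obtain i where i: "?t i = (b + (k - c)) mod k" "?t (Suc i) = b" by auto
    have "?t (k * i + (k - 1)) = ((b + (k - c)) mod k + (k - 1)) mod k"
      using k i by (subst gen_thue_morse_block) auto
    also have "\<dots> = (b + (k - Suc c) + k) mod k"
      using step.hyps step.prems k unfolding mod_add_left_eq by simp
    finally have 1: "?t (k * i + (k - 1)) = (b + (k - Suc c)) mod k" by simp
    have "Suc (k * i + (k - 1)) = k * Suc i + 0" using k by simp
    then have "?t (Suc (k * i + (k - 1))) = b"
      using k i assms by (simp only: gen_thue_morse_block) simp
    with 1 show ?case by blast
  qed
  \<comment> \<open>The range is \<open>1..k\<close> because the induction starts at difference 1;
    the case \<open>a = b\<close> is reached last, as \<open>c = k\<close>.\<close>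
  moreover have "\<exists>c. 1 \<le> c \<and> c \<le> k \<and> (b + (k - c)) mod k = a"
  proof (cases "a < b")
    case True
    then show ?thesis using assms by (intro exI[of _ "b - a"]) auto
  next
    case False
    then show ?thesis using assms by (intro exI[of _ "k + b - a"]) auto
  qed
  ultimately show ?thesis by blast
qed

text \<open>Strong induction on the distance. For \<open>m \<ge> k\<close>, desubstitute: letters at
  distance \<open>m div k\<close> head blocks that are far enough apart. For \<open>m < k\<close>,
  use two letters on either side of a block border, where adjacent pairs suffice.\<close>

lemma gen_thue_morse_pair:
  assumes k: "k \<ge> 2" and "a < k" "b < k" "m \<ge> 1"
  shows "\<exists>i. gen_thue_morse k i = a \<and> gen_thue_morse k (i + m) = b"
  using assms(2-)
proof (induction m arbitrary: a b rule: less_induct)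
  case (less m)
  let ?t = "gen_thue_morse k"
  define d where "d = m mod k"
  have d: "d < k" using k by (simp add: d_def)
  show ?case
  proof (cases "m < k")
    case False
    have m: "m = k * (m div k) + d" by (simp add: d_def)
    have "m div k \<ge> 1" using False k by (simp add: Suc_leI div_greater_zero_iff)
    moreover have "m div k < m" using less.prems k by simp
    ultimately obtain i where i: "?t i = a" "?t (i + m div k) = (b + (k - d)) mod k"
      using less.IH[of "m div k" a "(b + (k - d)) mod k"] less.prems k by auto
    have "k * i + m = k * (i + m div k) + d" using m by (simp add: algebra_simps)
    then have "?t (k * i + m) = b"
      using gen_thue_morse_block[OF k d, of "i + m div k"] i d less.prems
        mod_add_eq_solve[of b k d] by simp
    moreover have "?t (k * i) = a"
      using gen_thue_morse_block[OF k, of 0 i] i k less.prems by simp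
    ultimately show ?thesis by blast
  next
    case True
    \<comment> \<open>The block of \<open>a + 1\<close> ends with \<open>a\<close>; from there,
      distance \<open>m\<close> leads to offset \<open>m - 1\<close> of the next block.\<close>
    have "\<exists>i. ?t i = (a + 1) mod k \<and> ?t (Suc i) = (b + (k - (m - 1))) mod k"
      using k by (intro gen_thue_morse_adjacent_pair) auto
    then obtain i where i: "?t i = (a + 1) mod k" "?t (Suc i) = (b + (k - (m - 1))) mod k"
      by blast
    have "?t (k * i + (k - 1)) = ((a + 1) mod k + (k - 1)) mod k"
      using gen_thue_morse_block[OF k, of "k - 1" i] i k by simp
    also have "\<dots> = (a + k) mod k" using k unfolding mod_add_left_eq by simp
    also have "\<dots> = a" using less.prems by simp
    finally have 1: "?t (k * i + (k - 1)) = a" .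
    have "k * i + (k - 1) + m = k * Suc i + (m - 1)" using k less.prems by simp
    then have "?t (k * i + (k - 1) + m) = b"
      using gen_thue_morse_block[OF k, of "m - 1" "Suc i"] i True less.prems
        mod_add_eq_solve[of b k "m - 1"] by simp
    with 1 show ?thesis by blast
  qed
qed

section \<open>Cyclic differences of Parikh vectors\<close>

text \<open>The term \<open>k - 1\<close> stands for \<open>-1\<close> on naturals. Extending by
  zero beyond \<open>k\<close> allows comparison with \<open>signed_count\<close> as a
  function.\<close>

definition cyclic_diff :: "nat \<Rightarrow> nat list \<Rightarrow> nat \<Rightarrow> int" where
  "cyclic_diff k v c = (if c < k then int (v ! c) - int (v ! ((c + k - 1) mod k)) else 0)"

text \<open>Multiset subtraction truncates at zero, so the formal difference \<open>P - Q\<close> is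
  encoded by its integer multiplicities.\<close>

definition signed_count :: "'a multiset \<times> 'a multiset \<Rightarrow> 'a \<Rightarrow> int" where
  "signed_count PQ c = int (count (fst PQ) c) - int (count (snd PQ) c)"

definition letter_pairs :: "nat \<Rightarrow> nat multiset set" where
  "letter_pairs k = {{#x, y#} | x y. x < k \<and> y < k}"

text \<open>Here \<open>r\<close> is the residue of the factor length. The congruence determines
  each of the four letters from the other three.\<close>

definition shifted_pairs :: "nat \<Rightarrow> nat \<Rightarrow> (nat multiset \<times> nat multiset) set" where
  "shifted_pairs k r = {(P, Q). P \<in> letter_pairs k \<and> Q \<in> letter_pairs k \<and>
     sum_mset Q mod k = (sum_mset P + r) mod k}"

text \<open>Equal cyclic differences make \<open>u ! c - v ! c\<close> independent of
  \<open>c\<close>; equal sums force this constant to be zero.\<close>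

lemma cyclic_diff_inj:
  assumes "length u = k" "length v = k" "sum_list u = sum_list v"
    and eq: "cyclic_diff k u = cyclic_diff k v"
  shows "u = v"
proof (cases "k = 0")
  case True
  then show ?thesis using assms by simp
next
  case False
  define e where "e c = int (u ! c) - int (v ! c)" for c
  have const: "e c = e 0" if "c < k" for c
    using that
  proof (induction c)
    case (Suc c)
    have "(Suc c + k - 1) mod k = c" using Suc.prems by simp
    then have "e (Suc c) = e c"
      using fun_cong[OF eq, of "Suc c"] Suc.prems by (simp add: cyclic_diff_def e_def)
    then show ?case using Suc by simp
  qed simp
  have "(\<Sum>c<k. e c) = (\<Sum>c<k. e 0)" by (intro sum.cong refl const) simp
  moreover have "(\<Sum>c<k. e c) = int (sum_list u) - int (sum_list v)"
    using assms(1,2) by (simp add: e_def sum_subtractf sum_list_sum_nth atLeast0LessThan)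
  ultimately have "e 0 = 0" using False assms(3) by simp
  then have "e c = 0" if "c < k" for c using const[OF that] by simp
  then show ?thesis
    using assms(1,2) by (intro nth_equalityI) (auto simp: e_def)
qed

lemma sum_list_parikh:
  assumes "set v \<subseteq> {..<k}"
  shows "sum_list (parikh k v) = length v"
proof -
  have "sum_list (parikh k v) = (\<Sum>c<k. count_list v c)"
    by (simp add: parikh_def sum_list_sum_nth atLeast0LessThan)
  also have "\<dots> = (\<Sum>c\<in>set v. count_list v c)"
    using assms by (intro sum.mono_neutral_right) auto
  also have "\<dots> = length v" by (rule sum_count_set) auto
  finally show ?thesis .
qed

text \<open>The contribution of position \<open>j\<close> is an increment, which makes the sum over
  a factor telescope. Inside a block the next letter is \<open>t j + 1\<close> and the block letters
  cancel; at a block end \<open>t j + 1\<close> is the block letter itself, and the next letter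
  equals the letter of its own block.\<close>

lemma cyclic_diff_step:
  assumes k: "k \<ge> 2" and "c < k"
  defines "t \<equiv> gen_thue_morse k"
  shows "of_bool (t j = c) - of_bool (t j = (c + k - 1) mod k) =
    (of_bool (t (Suc j div k) = c) - of_bool (t (Suc j) = c)) -
    (of_bool (t (j div k) = c) - of_bool (t j = c) :: int)"
proof -
  have tj: "t j < k" using gen_thue_morse_less[OF k] by (simp add: t_def)
  have tj_rec: "t j = (t (j div k) + j mod k) mod k"
    unfolding t_def by (rule gen_thue_morse_rec[OF k])
  have *: "t j = (c + k - 1) mod k \<longleftrightarrow> (t j + 1) mod k = c"
  proof -
    have "(c + k - 1) mod k = (if c = 0 then k - 1 else c - 1)"
      using assms by (auto simp: mod_if)
    moreover have "(t j + 1) mod k = (if t j = k - 1 then 0 else t j + 1)"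
      using tj by (auto simp: mod_if)
    ultimately show ?thesis using tj \<open>c < k\<close> by auto
  qed
  show ?thesis
  proof (cases "Suc j mod k = 0")
    case False
    have "t (Suc j) = (t (Suc j div k) + Suc j mod k) mod k"
      unfolding t_def by (rule gen_thue_morse_rec[OF k])
    also have "\<dots> = (t (j div k) + j mod k + 1) mod k"
      using False by (simp add: mod_Suc div_Suc split: if_splits)
    also have "\<dots> = (t j + 1) mod k"
      unfolding mod_add_left_eq[symmetric, of "t (j div k) + j mod k"] tj_rec[symmetric] ..
    finally show ?thesis using False unfolding * by (simp add: div_Suc)
  next
    case True
    then have "j mod k = k - 1" by (simp add: mod_Suc split: if_splits)
    then have "(t j + 1) mod k = (t (j div k) + k) mod k"
      unfolding tj_rec using k by (simp only: mod_add_left_eq) (simp add: add.assoc)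
    then have "(t j + 1) mod k = t (j div k)"
      using gen_thue_morse_less[OF k] by (simp add: t_def)
    moreover have "t (Suc j) = t (Suc j div k)"
      unfolding t_def using True gen_thue_morse_less[OF k]
      by (subst gen_thue_morse_rec[OF k]) simp
    ultimately show ?thesis unfolding * by simp
  qed
qed

lemma cyclic_diff_parikh_factor:
  assumes k: "k \<ge> 2"
  defines "t \<equiv> gen_thue_morse k"
  shows "cyclic_diff k (parikh k (map t [i..<i + n])) =
    signed_count ({#t i, t ((i + n) div k)#}, {#t (i div k), t (i + n)#})"
proof
  fix c
  let ?G = "\<lambda>i. of_bool (t (i div k) = c) - of_bool (t i = c) :: int"
  show "cyclic_diff k (parikh k (map t [i..<i + n])) c =
    signed_count ({#t i, t ((i + n) div k)#}, {#t (i div k), t (i + n)#}) c"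
  proof (cases "c < k")
    case False
    then have "t j \<noteq> c" for j
      using gen_thue_morse_less[OF k, of j] by (auto simp: t_def)
    then show ?thesis using False by (simp add: cyclic_diff_def signed_count_def)
  next
    case True
    have "int (count_list (map t [i..<i + n]) c) -
        int (count_list (map t [i..<i + n]) ((c + k - 1) mod k)) = ?G (i + n) - ?G i"
    proof (induction n)
      case (Suc n)
      have "int (count_list (map t [i..<i + Suc n]) e) =
          int (count_list (map t [i..<i + n]) e) + of_bool (t (i + n) = e)" for e
        by simp
      note step = this[of c] this[of "(c + k - 1) mod k"]
      show ?case
        using Suc.IH step cyclic_diff_step[OF k True, of "i + n", folded t_def]
        unfolding add_Suc_right by linarith
    qed simp
    then show ?thesis using True by (simp add: cyclic_diff_def parikh_def signed_count_def)
  qed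
qed

text \<open>The recursion at \<open>i\<close> and at \<open>i + n\<close> gives the congruence.
  Conversely, three of the letters can be prescribed by choosing an offset and a pair of blocks, and
  the congruence then fixes the fourth.\<close>

lemma cyclic_diff_image:
  assumes k: "k \<ge> 2" and n: "n \<ge> k"
  shows "cyclic_diff k ` parikh k ` factors n (gen_thue_morse k) =
    signed_count ` shifted_pairs k (n mod k)"
proof (intro equalityI subsetI)
  let ?t = "gen_thue_morse k"
  fix d assume "d \<in> cyclic_diff k ` parikh k ` factors n ?t"
  then obtain i where d: "d = cyclic_diff k (parikh k (map ?t [i..<i + n]))"
    by (auto simp: factors_def)
  let ?P = "{#?t i, ?t ((i + n) div k)#}" and ?Q = "{#?t (i div k), ?t (i + n)#}"
  have "sum_mset ?Q mod k = (?t (i div k) + ?t (i + n)) mod k"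
    by simp
  also have "\<dots> = (?t (i div k) + (?t ((i + n) div k) + (i + n) mod k)) mod k"
    unfolding gen_thue_morse_rec[OF k, of "i + n"] by (rule mod_add_right_eq)
  also have "\<dots> = (?t (i div k) + ?t ((i + n) div k) + (i + n)) mod k"
    unfolding add.assoc[symmetric, of _ _ "_ mod k"] by (rule mod_add_right_eq)
  also have "\<dots> = (?t (i div k) + i + (?t ((i + n) div k) + n)) mod k"
    by (simp only: ac_simps)
  also have "\<dots> = ((?t (i div k) + i) mod k + (?t ((i + n) div k) + n)) mod k"
    by (rule mod_add_left_eq[symmetric])
  also have "(?t (i div k) + i) mod k = ?t i"
    unfolding gen_thue_morse_rec[OF k, of i] mod_add_right_eq ..
  also have "(?t i + (?t ((i + n) div k) + n)) mod k = (sum_mset ?P + n mod k) mod k"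
    unfolding mod_add_right_eq by (simp add: add.assoc)
  finally have "(?P, ?Q) \<in> shifted_pairs k (n mod k)"
    unfolding shifted_pairs_def letter_pairs_def using gen_thue_morse_less[OF k] by blast
  then show "d \<in> signed_count ` shifted_pairs k (n mod k)"
    unfolding d cyclic_diff_parikh_factor[OF k] by (rule imageI)
next
  let ?t = "gen_thue_morse k"
  fix d assume "d \<in> signed_count ` shifted_pairs k (n mod k)"
  then obtain x y z w where d: "d = signed_count ({#x, y#}, {#z, w#})"
    and less: "x < k" "y < k" "z < k" "w < k"
    and sums: "(z + w) mod k = (x + y + n mod k) mod k"
    by (auto simp: shifted_pairs_def letter_pairs_def)
  \<comment> \<open>The offset at which the block of \<open>z\<close> shows the letter
    \<open>x\<close>.\<close>
  define j where "j = (x + (k - z)) mod k"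
  have j: "j < k" "(z + j) mod k = x"
    using less mod_add_eq_solve[of x k z] by (auto simp: j_def add.commute)
  \<comment> \<open>The block distance \<open>(j + n) div k\<close> is positive because
    \<open>n \<ge> k\<close>.\<close>
  obtain I where I: "?t I = z" "?t (I + (j + n) div k) = y"
    using gen_thue_morse_pair[OF k less(3,2), of "(j + n) div k"] n k
    by (auto simp: Suc_le_eq div_greater_zero_iff)
  let ?i = "k * I + j"
  have ti: "?t ?i = x" using gen_thue_morse_block[OF k j(1)] I j by simp
  have div: "?i div k = I" "(?i + n) div k = I + (j + n) div k"
    using j k by (simp_all add: add.assoc)
  have "?t (?i + n) = (y + (?i + n) mod k) mod k"
    using gen_thue_morse_rec[OF k, of "?i + n"] I by (simp only: div)
  also have "\<dots> = (y + (j + n)) mod k"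
    by (simp add: mod_add_right_eq add.assoc)
  finally have "(z + ?t (?i + n)) mod k = (z + (y + (j + n))) mod k"
    by (simp only: mod_add_right_eq)
  also have "\<dots> = ((z + j) + (y + n)) mod k"
    by (simp only: ac_simps)
  also have "\<dots> = ((z + j) mod k + (y + n)) mod k"
    by (rule mod_add_left_eq[symmetric])
  also have "\<dots> = (x + y + n mod k) mod k"
    unfolding j mod_add_right_eq by (simp only: ac_simps)
  also have "\<dots> = (z + w) mod k" by (rule sums[symmetric])
  finally have "?t (?i + n) = w"
    using mod_add_left_cancel gen_thue_morse_less[OF k] less(4) by blast
  then have "cyclic_diff k (parikh k (map ?t [?i..<?i + n])) = d"
    unfolding cyclic_diff_parikh_factor[OF k] d using ti I by (simp only: div)
  then show "d \<in> cyclic_diff k ` parikh k ` factors n ?t"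
    unfolding factors_def by blast
qed

text \<open>Parikh vectors of factors of length \<open>n\<close> all have length \<open>k\<close>
  and sum \<open>n\<close>, so \<open>cyclic_diff\<close> is injective on them.\<close>

lemma abelian_complexity_eq_card_signed_count:
  assumes k: "k \<ge> 2" and n: "n \<ge> k"
  shows "abelian_complexity k (gen_thue_morse k) n =
    card (signed_count ` shifted_pairs k (n mod k))"
proof -
  have "inj_on (cyclic_diff k) (parikh k ` factors n (gen_thue_morse k))"
  proof (intro inj_onI cyclic_diff_inj[where k = k])
    fix u v assume "u \<in> parikh k ` factors n (gen_thue_morse k)"
      "v \<in> parikh k ` factors n (gen_thue_morse k)"
    moreover have "length u = k \<and> sum_list u = n"
      if "u \<in> parikh k ` factors n (gen_thue_morse k)" for u
      using that gen_thue_morse_less[OF k]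
      by (auto simp: factors_def sum_list_parikh image_subset_iff) (simp add: parikh_def)
    ultimately show "length u = k" "length v = k" "sum_list u = sum_list v" by auto
  qed
  then show ?thesis
    unfolding abelian_complexity_def cyclic_diff_image[OF assms, symmetric]
    by (simp add: card_image)
qed

section \<open>Counting pairs of multisets\<close>

lemma doubleton_mset_eq_iff:
  "{#a, b#} = {#c, d#} \<longleftrightarrow> a = c \<and> b = d \<or> a = d \<and> b = c"
  by (auto simp: add_eq_conv_ex)

lemma letter_pairsI: "x < k \<Longrightarrow> y < k \<Longrightarrow> {#x, y#} \<in> letter_pairs k"
  unfolding letter_pairs_def by blast

lemma finite_letter_pairs: "finite (letter_pairs k)"
proof -
  have "letter_pairs k = (\<lambda>(x, y). {#x, y#}) ` ({..<k} \<times> {..<k})"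
    by (auto simp: letter_pairs_def)
  then show ?thesis by simp
qed

lemma card_ordered_pairs_sum:
  fixes k c :: nat
  assumes "c < k"
  shows "card {(x, y). x < k \<and> y < k \<and> (x + y) mod k = c} = k"
proof -
  have eq: "{(x, y). x < k \<and> y < k \<and> (x + y) mod k = c} = (\<lambda>x. (x, (c + (k - x)) mod k)) ` {..<k}"
  proof (intro equalityI subsetI)
    fix p assume "p \<in> {(x, y). x < k \<and> y < k \<and> (x + y) mod k = c}"
    then obtain x y where p: "p = (x, y)" "x < k" "y < k" "(x + y) mod k = c" by auto
    then have "(x + y) mod k = (x + (c + (k - x)) mod k) mod k"
      using mod_add_eq_solve[OF assms, of x] by (simp add: add.commute)
    then have "y = (c + (k - x)) mod k"
      using p by (intro mod_add_left_cancel[of x y k]) auto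
    then show "p \<in> (\<lambda>x. (x, (c + (k - x)) mod k)) ` {..<k}" using p by auto
  next
    fix p assume "p \<in> (\<lambda>x. (x, (c + (k - x)) mod k)) ` {..<k}"
    then show "p \<in> {(x, y). x < k \<and> y < k \<and> (x + y) mod k = c}"
      using mod_add_eq_solve[OF assms] by (auto simp: add.commute)
  qed
  have "inj_on (\<lambda>x. (x, (c + (k - x)) mod k)) {..<k}" by (auto simp: inj_on_def)
  then show ?thesis unfolding eq by (simp only: card_image card_lessThan)
qed

text \<open>These index the diagonal multisets \<open>{#x, x#}\<close> of residue \<open>c\<close>,
  which come from only one ordered pair instead of two.\<close>

definition halves :: "nat \<Rightarrow> nat \<Rightarrow> nat set" where
  "halves k c = {x \<in> {..<k}. 2 * x mod k = c}"

text \<open>The \<open>k\<close> ordered pairs of residue \<open>c\<close> count each multiset in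
  \<open>L\<close> twice and each diagonal one once; counting the diagonal once more gives exactly
  twice the multisets.\<close>

lemma card_letter_pairs_sum:
  fixes k c :: nat
  assumes "c < k"
  shows "2 * card {P \<in> letter_pairs k. sum_mset P mod k = c} =
    k + card (halves k c)"
proof -
  define L where "L = {(x, y). x < y \<and> y < k \<and> (x + y) mod k = c}"
  define D where "D = halves k c"
  have D: "x \<in> D \<longleftrightarrow> x < k \<and> (x + x) mod k = c" for x
    by (simp add: D_def halves_def mult_2)
  have fin: "finite L" "finite D"
    by (rule finite_subset[of _ "{..<k} \<times> {..<k}"]; force simp: L_def) (simp add: D_def halves_def)
  have "{(x, y). x < k \<and> y < k \<and> (x + y) mod k = c} = (L \<union> prod.swap ` L) \<union> (\<lambda>x. (x, x)) ` D"
  proof (intro equalityI subsetI)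
    fix p assume "p \<in> {(x, y). x < k \<and> y < k \<and> (x + y) mod k = c}"
    then obtain x y where p: "p = (x, y)" "x < k" "y < k" "(x + y) mod k = c" by auto
    consider "x < y" | "y < x" | "x = y" by linarith
    then show "p \<in> (L \<union> prod.swap ` L) \<union> (\<lambda>x. (x, x)) ` D"
    proof cases
      case 2
      then have "(y, x) \<in> L" using p by (simp add: L_def add.commute)
      then show ?thesis using p by force
    qed (use p in \<open>auto simp: L_def D\<close>)
  qed (auto simp: L_def D add.commute)
  moreover have "card ((L \<union> prod.swap ` L) \<union> (\<lambda>x. (x, x)) ` D) =
      card (L \<union> prod.swap ` L) + card ((\<lambda>x. (x, x)) ` D)"
    using fin by (intro card_Un_disjoint) (auto simp: L_def)
  moreover have "card (L \<union> prod.swap ` L) = card L + card (prod.swap ` L)"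
    using fin by (intro card_Un_disjoint) (auto simp: L_def)
  moreover have "card (prod.swap ` L) = card L" by (intro card_image) auto
  moreover have "card ((\<lambda>x. (x, x)) ` D) = card D" by (intro card_image) (auto simp: inj_on_def)
  ultimately have ordered: "2 * card L + card D = k"
    using card_ordered_pairs_sum[OF assms] by simp
  have "{P \<in> letter_pairs k. sum_mset P mod k = c} =
      (\<lambda>(x, y). {#x, y#}) ` L \<union> (\<lambda>x. {#x, x#}) ` D"
  proof (intro equalityI subsetI)
    fix P assume "P \<in> {P \<in> letter_pairs k. sum_mset P mod k = c}"
    then obtain x y where P: "P = {#x, y#}" "x < k" "y < k" "(x + y) mod k = c"
      by (auto simp: letter_pairs_def)
    consider "x < y" | "y < x" | "x = y" by linarith
    then show "P \<in> (\<lambda>(x, y). {#x, y#}) ` L \<union> (\<lambda>x. {#x, x#}) ` D"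
    proof cases
      case 2
      then have "(y, x) \<in> L" "P = {#y, x#}"
        using P by (simp_all add: L_def add.commute add_mset_commute)
      then show ?thesis by force
    qed (use P in \<open>auto simp: L_def D\<close>)
  qed (auto simp: L_def D intro!: letter_pairsI)
  moreover have "card ((\<lambda>(x, y). {#x, y#}) ` L \<union> (\<lambda>x. {#x, x#}) ` D) =
      card ((\<lambda>(x, y). {#x, y#}) ` L) + card ((\<lambda>x. {#x, x#}) ` D)"
    using fin by (intro card_Un_disjoint) (auto simp: L_def doubleton_mset_eq_iff)
  moreover have "card ((\<lambda>(x, y). {#x, y#}) ` L) = card L"
    by (intro card_image) (auto simp: inj_on_def L_def doubleton_mset_eq_iff)
  moreover have "card ((\<lambda>x. {#x, x#}) ` D) = card D"
    by (intro card_image) (auto simp: inj_on_def doubleton_mset_eq_iff)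
  ultimately show ?thesis using ordered unfolding D_def by simp
qed

lemma card_letter_pairs:
  assumes "k > 0"
  shows "2 * card (letter_pairs k) = k * k + k"
proof -
  have "card (letter_pairs k) = (\<Sum>c<k. card {P \<in> letter_pairs k. sum_mset P mod k = c})"
    using sum.group[of "letter_pairs k" "{..<k}" "\<lambda>P. sum_mset P mod k" "\<lambda>_. 1 :: nat"] assms
    by (simp add: finite_letter_pairs image_subset_iff)
  \<comment> \<open>Every \<open>x < k\<close> lies in \<open>halves k c\<close> for exactly one
    \<open>c\<close>.\<close>
  moreover have "k = (\<Sum>c<k. card (halves k c))"
    using sum.group[of "{..<k}" "{..<k}" "\<lambda>x. 2 * x mod k" "\<lambda>_. 1 :: nat"] assms
    by (simp add: halves_def image_subset_iff)
  moreover have "(\<Sum>c<k. 2 * card {P \<in> letter_pairs k. sum_mset P mod k = c}) =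
      (\<Sum>c<k. k + card (halves k c))"
    by (intro sum.cong refl card_letter_pairs_sum) simp
  ultimately show ?thesis by (simp add: sum.distrib sum_distrib_left)
qed

text \<open>Once the residue \<open>c\<close> of \<open>P\<close> is fixed, \<open>P\<close> and
  \<open>Q\<close> are chosen independently. The factor 4 clears the factor 2 of
  \<open>card_letter_pairs_sum\<close> on both sides.\<close>

lemma card_shifted_pairs:
  assumes "k > 0"
  shows "4 * card (shifted_pairs k r) =
    (\<Sum>c<k. (k + card (halves k c)) *
            (k + card (halves k ((c + r) mod k))))"
proof -
  define W where "W c = {P \<in> letter_pairs k. sum_mset P mod k = c}" for c
  have "shifted_pairs k r = Sigma (letter_pairs k) (\<lambda>P. W ((sum_mset P + r) mod k))"
    by (auto simp: shifted_pairs_def W_def)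
  then have "card (shifted_pairs k r) =
      (\<Sum>P\<in>letter_pairs k. card (W ((sum_mset P + r) mod k)))"
    using finite_letter_pairs by (simp add: W_def)
  also have "\<dots> = (\<Sum>c<k. \<Sum>P\<in>W c. card (W ((sum_mset P + r) mod k)))"
    unfolding W_def using assms finite_letter_pairs
    by (intro sum.group[symmetric]) auto
  also have "\<dots> = (\<Sum>c<k. card (W c) * card (W ((c + r) mod k)))"
  proof (intro sum.cong refl)
    fix c
    have "(\<Sum>P\<in>W c. card (W ((sum_mset P + r) mod k))) = (\<Sum>P\<in>W c. card (W ((c + r) mod k)))"
      by (intro sum.cong refl) (auto simp: W_def mod_add_left_eq)
    then show "(\<Sum>P\<in>W c. card (W ((sum_mset P + r) mod k))) = card (W c) * card (W ((c + r) mod k))"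
      by simp
  qed
  finally have "4 * card (shifted_pairs k r) =
      (\<Sum>c<k. (2 * card (W c)) * (2 * card (W ((c + r) mod k))))"
    by (simp add: sum_distrib_left mult.assoc mult.left_commute)
  also have "\<dots> = (\<Sum>c<k. (k + card (halves k c)) *
            (k + card (halves k ((c + r) mod k))))"
    using assms by (intro sum.cong refl) (simp add: W_def card_letter_pairs_sum)
  finally show ?thesis .
qed

section \<open>Halving modulo \<open>k\<close> and the resulting pair counts\<close>

lemma double_mod:
  fixes x k :: nat
  assumes "x < k"
  shows "2 * x mod k = (if 2 * x < k then 2 * x else 2 * x - k)"
  using assms by (simp add: mod_if)

text \<open>Since 2 is invertible, the only solution is whichever of \<open>c / 2\<close> and
  \<open>(c + k) / 2\<close> is an integer.\<close>

lemma card_halves_odd: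
  fixes k c :: nat
  assumes "odd k" "c < k"
  shows "card (halves k c) = 1"
proof -
  have iff: "x < k \<and> (if 2 * x < k then 2 * x else 2 * x - k) = c \<longleftrightarrow>
      x = (if even c then c div 2 else (c + k) div 2)" for x
    using assms by (elim oddE, cases "even c") (auto elim!: evenE oddE, presburger+)
  have "x \<in> halves k c \<longleftrightarrow> x = (if even c then c div 2 else (c + k) div 2)" for x
    unfolding iff[symmetric] halves_def using double_mod[of x k] by auto
  then have "halves k c = {if even c then c div 2 else (c + k) div 2}"
    by blast
  then show ?thesis by simp
qed

text \<open>Doubling preserves evenness modulo an even \<open>k\<close>, and its two solutions
  differ by \<open>k div 2\<close>.\<close>

lemma card_halves_even:
  fixes k c :: nat
  assumes "even k" "c < k"
  shows "card (halves k c) = (if even c then 2 else 0)"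
proof -
  have iff: "x < k \<and> (if 2 * x < k then 2 * x else 2 * x - k) = c \<longleftrightarrow>
      even c \<and> (x = c div 2 \<or> x = c div 2 + k div 2)" for x
    using assms by (elim evenE, cases "even c") (auto elim!: evenE oddE, presburger+)
  have "x \<in> halves k c \<longleftrightarrow> even c \<and> (x = c div 2 \<or> x = c div 2 + k div 2)" for x
    unfolding iff[symmetric] halves_def using double_mod[of x k] by auto
  then have "halves k c = (if even c then {c div 2, c div 2 + k div 2} else {})"
    by auto
  then show ?thesis using assms by auto
qed

lemma sum_by_parity:
  fixes A B :: nat
  shows "(\<Sum>c<2 * h. if even c then A else B) = h * (A + B)"
  by (induction h) (simp_all add: algebra_simps)

lemma card_shifted_pairs_odd:
  assumes "odd k"
  shows "4 * card (shifted_pairs k r) = k * (k + 1) * (k + 1)"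
proof -
  have "4 * card (shifted_pairs k r) = (\<Sum>c<k. (k + 1) * (k + 1))"
    using assms odd_pos[OF assms] unfolding card_shifted_pairs[OF odd_pos[OF assms]]
    by (intro sum.cong refl) (simp add: card_halves_odd)
  then show ?thesis by (simp add: algebra_simps)
qed

text \<open>Even residues contribute a factor \<open>k + 2\<close> and odd ones a factor
  \<open>k\<close>. An even shift multiplies equal factors, an odd shift mixes them.\<close>

lemma card_shifted_pairs_even:
  assumes "k = 2 * h" "h > 0"
  shows "4 * card (shifted_pairs k r) =
    (if even r then h * ((k + 2) * (k + 2) + k * k) else 2 * h * (k + 2) * k)"
proof -
  have parity: "even ((c + r) mod k) \<longleftrightarrow> even (c + r)" for c
    using assms by (simp add: dvd_mod_iff)
  have k: "k > 0" "even k" using assms by auto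
  have "4 * card (shifted_pairs k r) = (\<Sum>c<k. if even c
      then (k + 2) * (if even r then k + 2 else k) else k * (if even r then k else k + 2))"
    unfolding card_shifted_pairs[OF k(1)]
    using k by (intro sum.cong refl) (simp add: card_halves_even parity)
  also have "\<dots> = (\<Sum>c<2 * h. if even c
      then (k + 2) * (if even r then k + 2 else k) else k * (if even r then k else k + 2))"
    by (simp only: assms(1))
  finally show ?thesis unfolding sum_by_parity by (simp add: algebra_simps)
qed

section \<open>Counting differences\<close>

text \<open>Cancelling common letters gives a canonical representative of the formal
  difference.\<close>

definition mset_reduce :: "'a multiset \<times> 'a multiset \<Rightarrow> 'a multiset \<times> 'a multiset" where
  "mset_reduce PQ = (fst PQ - snd PQ, snd PQ - fst PQ)"

definition meeting_pairs :: "nat \<Rightarrow> nat \<Rightarrow> (nat multiset \<times> nat multiset) set" where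
  "meeting_pairs k r = {(P, Q) \<in> shifted_pairs k r. P \<inter># Q \<noteq> {#}}"

text \<open>The two components of \<open>mset_reduce\<close> are the positive and negative parts of
  \<open>signed_count\<close>, so both maps have the same fibres.\<close>

lemma card_signed_count_image: "card (signed_count ` E) = card (mset_reduce ` E)"
proof -
  have reduce: "signed_count PQ = signed_count (mset_reduce PQ)" for PQ :: "'a multiset \<times> 'a multiset"
    by (auto simp: signed_count_def mset_reduce_def)
  have "mset_reduce PQ = mset_reduce PQ'" if eq: "signed_count PQ = signed_count PQ'"
    for PQ PQ' :: "'a multiset \<times> 'a multiset"
  proof -
    have pos: "count (fst PQ - snd PQ) c = nat (signed_count PQ c)"
      and neg: "count (snd PQ - fst PQ) c = nat (- signed_count PQ c)"
      for c and PQ :: "'a multiset \<times> 'a multiset"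
      by (auto simp: signed_count_def)
    have "fst PQ - snd PQ = fst PQ' - snd PQ'" by (rule multiset_eqI) (simp only: pos eq)
    moreover have "snd PQ - fst PQ = snd PQ' - fst PQ'"
      by (rule multiset_eqI) (simp only: neg eq)
    ultimately show ?thesis by (simp only: mset_reduce_def)
  qed
  then have "inj_on signed_count (mset_reduce ` E)"
    by (intro inj_onI) (metis imageE reduce)
  moreover have "signed_count ` E = signed_count ` mset_reduce ` E"
    by (simp add: image_image reduce[symmetric])
  ultimately show ?thesis by (simp add: card_image)
qed

lemma finite_shifted_pairs: "finite (shifted_pairs k r)"
  by (rule finite_subset[of _ "letter_pairs k \<times> letter_pairs k"])
    (auto simp: shifted_pairs_def finite_letter_pairs)

text \<open>Removing a common letter \<open>x\<close> from both sides of the congruence leaves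
  \<open>w = y + r\<close> modulo \<open>k\<close>.\<close>

lemma meeting_pairs_eq:
  "meeting_pairs k r = (\<lambda>(x, y). ({#x, y#}, {#x, (y + r) mod k#})) ` ({..<k} \<times> {..<k})"
proof (intro equalityI subsetI)
  fix p assume "p \<in> meeting_pairs k r"
  then obtain P Q x where p: "p = (P, Q)" and PQ: "(P, Q) \<in> shifted_pairs k r"
    and x: "x \<in># P" "x \<in># Q"
    unfolding meeting_pairs_def by (auto simp: multiset_eq_iff)
  have "\<exists>y. P = {#x, y#} \<and> x < k \<and> y < k" if "P \<in> letter_pairs k" "x \<in># P" for P
    using that by (auto simp: letter_pairs_def add_mset_commute)
  then obtain y w where yw: "P = {#x, y#}" "Q = {#x, w#}" "x < k" "y < k" "w < k"
    using PQ x unfolding shifted_pairs_def by blast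
  have "(x + w) mod k = (x + (y + r) mod k) mod k"
    using PQ unfolding mod_add_right_eq by (simp add: shifted_pairs_def yw add.assoc)
  then have "w = (y + r) mod k"
    using yw by (intro mod_add_left_cancel[of x w k]) auto
  then show "p \<in> (\<lambda>(x, y). ({#x, y#}, {#x, (y + r) mod k#})) ` ({..<k} \<times> {..<k})"
    using p yw by auto
next
  fix p assume "p \<in> (\<lambda>(x, y). ({#x, y#}, {#x, (y + r) mod k#})) ` ({..<k} \<times> {..<k})"
  then obtain x y where p: "p = ({#x, y#}, {#x, (y + r) mod k#})" "x < k" "y < k" by auto
  have "(x + (y + r) mod k) mod k = (x + y + r) mod k"
    unfolding mod_add_right_eq by (simp add: add.assoc)
  moreover have "(y + r) mod k < k" using p by simp
  ultimately show "p \<in> meeting_pairs k r"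
    using p unfolding meeting_pairs_def shifted_pairs_def by (auto intro: letter_pairsI)
qed

text \<open>Disjoint pairs are fixed by the reduction and keep size 2, while meeting pairs drop
  below 2. The two images are therefore disjoint, and only meeting pairs need a correction.\<close>

lemma card_mset_reduce_image:
  "card (mset_reduce ` shifted_pairs k r) + card (meeting_pairs k r) =
    card (shifted_pairs k r) + card (mset_reduce ` meeting_pairs k r)"
proof -
  define D where "D = shifted_pairs k r - meeting_pairs k r"
  have E: "shifted_pairs k r = D \<union> meeting_pairs k r" "D \<inter> meeting_pairs k r = {}"
    by (auto simp: D_def meeting_pairs_def)
  have fin: "finite D" "finite (meeting_pairs k r)"
    using finite_shifted_pairs E(1) by (metis finite_Un)+
  have "mset_reduce PQ = PQ" if "PQ \<in> D" for PQ
  proof -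
    obtain P Q where PQ: "PQ = (P, Q)" "P \<inter># Q = {#}"
      using \<open>PQ \<in> D\<close> by (cases PQ) (auto simp: D_def meeting_pairs_def)
    then have "P - Q = P" "Q - P = Q"
      by (metis diff_intersect_left_idem diff_empty)
        (metis PQ(2) diff_intersect_right_idem diff_empty)
    then show ?thesis by (simp add: PQ mset_reduce_def)
  qed
  then have "mset_reduce ` D = D" by force
  then have "mset_reduce ` shifted_pairs k r = D \<union> mset_reduce ` meeting_pairs k r"
    unfolding E(1) image_Un by simp
  moreover have "D \<inter> mset_reduce ` meeting_pairs k r = {}"
  proof -
    have "size (fst PQ) = 2" if "PQ \<in> D" for PQ
      using that by (auto simp: D_def shifted_pairs_def letter_pairs_def)
    moreover have "size (fst PQ) < 2" if "PQ \<in> mset_reduce ` meeting_pairs k r" for PQ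
    proof -
      obtain x y z where "fst PQ = {#x, y#} - {#x, z#}"
        using \<open>PQ \<in> _\<close> by (auto simp: meeting_pairs_eq mset_reduce_def)
      then have "fst PQ = {#y#} - {#z#}" by simp
      then have "size (fst PQ) \<le> size {#y#}" by (metis diff_subset_eq_self size_mset_mono)
      then show ?thesis by simp
    qed
    ultimately show ?thesis by fastforce
  qed
  ultimately have "card (mset_reduce ` shifted_pairs k r) =
      card D + card (mset_reduce ` meeting_pairs k r)"
    using fin by (simp add: card_Un_disjoint)
  moreover have "card (shifted_pairs k r) = card D + card (meeting_pairs k r)"
    using E fin by (metis card_Un_disjoint)
  ultimately show ?thesis by simp
qed

text \<open>For a nonzero shift, \<open>x\<close> and \<open>y\<close> can be recovered from a
  meeting pair, giving \<open>k * k\<close> of them; reduction forgets \<open>x\<close> and leaves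
  \<open>k\<close> differences.\<close>

lemma card_signed_count_shift:
  assumes "0 < r" "r < k"
  shows "card (signed_count ` shifted_pairs k r) + k * k = card (shifted_pairs k r) + k"
proof -
  have ne: "(y + r) mod k \<noteq> y" if "y < k" for y
    using that assms mod_add_left_cancel[of y r k 0] by auto
  have inj: "y = z" if "(y + r) mod k = (z + r) mod k" "y < k" "z < k" for y z
    using that mod_add_left_cancel[of r y k z] by (simp add: add.commute)
  \<comment> \<open>If \<open>x\<close> and \<open>y\<close> were interchanged, the second multisets
    would force \<open>x = y\<close> or a letter fixed by the shift, contrary to
    \<open>ne\<close>.\<close>
  have "inj_on (\<lambda>(x, y). ({#x, y#}, {#x, (y + r) mod k#})) ({..<k} \<times> {..<k})"
  proof (rule inj_onI, clarsimp)
    fix x y x' y' assume "y < k" "y' < k" "{#x, y#} = {#x', y'#}"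
      "{#x, (y + r) mod k#} = {#x', (y' + r) mod k#}"
    then show "x = x' \<and> y = y'"
      unfolding doubleton_mset_eq_iff using ne inj by metis
  qed
  then have "card (meeting_pairs k r) = k * k"
    unfolding meeting_pairs_eq by (simp add: card_image)
  moreover have "mset_reduce ` meeting_pairs k r = (\<lambda>y. ({#y#}, {#(y + r) mod k#})) ` {..<k}"
  proof -
    have "mset_reduce ({#x, y#}, {#x, (y + r) mod k#}) = ({#y#}, {#(y + r) mod k#})"
      if "y < k" for x y
      using ne[OF that] by (simp add: mset_reduce_def)
    then have "mset_reduce ` meeting_pairs k r =
        (\<lambda>y. ({#y#}, {#(y + r) mod k#})) ` snd ` ({..<k} \<times> {..<k})"
      unfolding meeting_pairs_eq image_image by (intro image_cong refl) auto
    then show ?thesis using assms by (simp add: snd_image_times)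
  qed
  then have "card (mset_reduce ` meeting_pairs k r) = k"
    by (simp add: card_image inj_on_def)
  ultimately show ?thesis
    using card_mset_reduce_image[of k r] by (simp add: card_signed_count_image)
qed

text \<open>Without a shift, the meeting pairs are the pairs \<open>(P, P)\<close>, and all of them
  collapse to the zero difference.\<close>

lemma card_signed_count_no_shift:
  assumes "k > 0"
  shows "2 * card (signed_count ` shifted_pairs k 0) + k * k + k = 2 * card (shifted_pairs k 0) + 2"
proof -
  have "meeting_pairs k 0 = (\<lambda>P. (P, P)) ` letter_pairs k"
    unfolding meeting_pairs_eq letter_pairs_def by force
  moreover have "card ((\<lambda>P. (P, P)) ` letter_pairs k) = card (letter_pairs k)"
    by (intro card_image) (auto simp: inj_on_def)
  moreover have "{#0, 0#} \<in> letter_pairs k" using assms by (auto simp: letter_pairs_def)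
  then have "mset_reduce ` (\<lambda>P. (P, P)) ` letter_pairs k = {({#}, {#})}"
    by (auto simp: mset_reduce_def image_image image_constant)
  ultimately show ?thesis
    using card_mset_reduce_image[of k 0] card_letter_pairs[OF assms]
    by (simp add: card_signed_count_image)
qed

section \<open>Assembly of the closed formulas\<close>

theorem theorem1:
  fixes k n r :: nat
  assumes "k \<ge> 2" and "n \<ge> k" and "r = n mod k"
  shows "real (abelian_complexity k (gen_thue_morse k) n) =
    (if odd k \<and> r = 0 then 1/4 * real k * ((real k)\<^sup>2 - 1) + 1
     else if odd k \<and> r \<noteq> 0 then 1/4 * real k * (real k - 1)\<^sup>2 + real k
     else if even k \<and> r = 0 then 1/4 * real k ^ 3 + 1
     else if even k \<and> r \<noteq> 0 \<and> even r then 1/4 * real k * (real k - 1)\<^sup>2 + 5/4 * real k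
     else 1/4 * (real k)\<^sup>2 * (real k - 2) + real k)"
proof -
  define N where "N = abelian_complexity k (gen_thue_morse k) n"
  define E where "E = card (shifted_pairs k r)"
  have N: "N = card (signed_count ` shifted_pairs k r)"
    using abelian_complexity_eq_card_signed_count[OF assms(1,2)] assms(3) by (simp add: N_def)
  \<comment> \<open>Over the reals the corrections become honest subtractions:
    \<open>k\<^sup>2 - k\<close> for a nonzero residue, \<open>(k\<^sup>2 + k) / 2 - 1\<close> for
    residue zero.\<close>
  have shift: "real N + real k * real k = real E + real k" if "r \<noteq> 0"
    using card_signed_count_shift[of r k] that assms(1,3)
    unfolding N E_def of_nat_add[symmetric] of_nat_mult[symmetric] by simp
  have no_shift: "2 * real N + real k * real k + real k = 2 * real E + 2" if "r = 0"
    using arg_cong[OF card_signed_count_no_shift[of k], of real] that assms(1)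
    by (simp add: N E_def)
  show ?thesis
  proof (cases "even k")
    case False
    have "4 * real E = real k * (real k + 1) * (real k + 1)"
      using arg_cong[OF card_shifted_pairs_odd[OF False, of r], of real]
      by (simp add: E_def algebra_simps)
    then show ?thesis
      unfolding N_def[symmetric] using False shift no_shift
      by (cases "r = 0") (simp_all add: field_simps power2_eq_square)
  next
    case True
    then obtain h where h: "k = 2 * h" by blast
    have "4 * real E = (if even r then real h * ((real k + 2) * (real k + 2) + real k * real k)
        else 2 * real h * (real k + 2) * real k)"
      using arg_cong[OF card_shifted_pairs_even[OF h, of r], of real] h assms(1)
      by (auto simp: E_def algebra_simps)
    then show ?thesis
      unfolding N_def[symmetric] using True shift no_shift h
      by (cases "r = 0"; cases "even r")
        (simp_all add: field_simps power2_eq_square power3_eq_cube)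
  qed
qed

end
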